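(* Let $\mathcal{G}$ be a DAG with vertex set $V=\{1,\dots,p\}$ whose edges are consistent with the ordering $1<\dots<p$, let $A\subseteq V$, and let $\mathcal{G}^*$ be the corresponding augmented DAG. Suppose the kernel $p(W_V\mid F_A)$ obeys distributional consistency and the augmented DAG local Markov property with respect to $\mathcal{G}^*$. Let $b$ be an assignment to the intervention targets in $B\subseteq A$, and let $w^*$ be an assignment to $W_V$. Then for every $i\in V$: $$p(W_i=w^*_i\mid F_B=b,\,W_{\mathrm{pre}(i)}=w^*_{\mathrm{pre}(i)})=p(W_i=w^*_i\mid W_{\mathrm{pa}(i)\cap B}=b_{\mathrm{pa}(i)\cap B},\,W_{\mathrm{pa}(i)\setminus B}=w^*_{\mathrm{pa}(i)\setminus B}).$$ Consequently, $p(W_V\mid F_B=b)$ is identified given $p(W_V)$ and obeys the Markov property for the augmented DAG $\mathcal{G}^{**}$ formed from $\mathcal{G}^*$ by removing all outgoing edges from vertices in $B$ and removing the regime indicators $F_{A\setminus B}$.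
   Context: Variables are indexed by $V=\{1,\dots,p\}$, with state spaces $\mathfrak{X}_i$; $\mathfrak{X}_D=\prod_{i\in D}\mathfrak{X}_i$, and $x_D$ is the restriction of an assignment $x$ to $D$. $A\subseteq V$ is the set of intervention targets. Each $i\in A$ has a non-stochastic regime indicator $F_i$ taking values in $\mathfrak{X}_i\cup\{\emptyset\}$, where $\emptyset$ ("idle") means no intervention on $i$, and $F_i=a_i\in\mathfrak{X}_i$ means that target $i$ is set to $a_i$. For $i\in A$, $W_i$ is the natural (intention-to-treat) value of the target. The kernel $p(W_V\mid F_A)$ assigns to each value of $F_A=(F_i)_{i\in A}$ a distribution for the random vector $W_V=(W_i)_{i\in V}$. Regime indicators that are not mentioned are idle, so $p(\cdot\mid F_C=c)$ means $F_C=c$ and $F_{A\setminus C}=\emptyset$; the observed distribution $p(W_V)$ has all indicators idle. The shorthand $F_C\neq\emptyset$ means $F_j\neq\emptyset$ for all $j\in C$. Distributional consistency: for every $j\in A$ and $C\subseteq A\setminus\{j\}$ (possibly empty), $W_V\perp F_j^*\mid F_C,\,F_C\neq\emptyset$, where $F_j^*$ is a regime indicator taking the values $\emptyset$ and $g_j^*$, and $g_j^*$ is the dynamic regime that sets target $j$ to its natural value $W_j$. Equivalently, for all $c\in\mathfrak{X}_C$ and $v\in\mathfrak{X}_V$: $p(W_V=v\mid F_j=v_j,F_C=c)=p(W_V=v\mid F_C=c)$. $\mathrm{pa}(i)$ is the set of parents of $i$ in $\mathcal{G}$ and $\mathrm{pre}(i)=\{1,\dots,i-1\}$. The augmented DAG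 $\mathcal{G}^*$ has vertex set $V\cup\{F_i: i\in A\}$, the edges of $\mathcal{G}$, and an edge $F_i\to j$ whenever $i\in A$ and $i\to j$ in $\mathcal{G}$. Augmented DAG local Markov property for $\mathcal{G}^*$: for all $i\in V$, $$W_i\perp F_{A\setminus \mathrm{pa}(i)},\,W_{\mathrm{pre}(i)\setminus(\mathrm{pa}(i)\setminus A)}\mid W_{\mathrm{pa}(i)\setminus A},\,F_{A\cap \mathrm{pa}(i)},\,F_A\neq\emptyset;$$ i.e. for $a\in\mathfrak{X}_A$ (all indicators non-idle) and $w\in\mathfrak{X}_{\mathrm{pre}(i)}$, the conditional distribution $p(W_i\mid W_{\mathrm{pre}(i)}=w,F_A=a)$ is a function only of $a_{A\cap \mathrm{pa}(i)}$ and $w_{\mathrm{pa}(i)\setminus A}$. "Identified given $p(W_V)$" means determined by the observed distribution $p(W_V)$. The graph $\mathcal{G}^{**}$ has vertex set $V\cup\{F_i:i\in B\}$, and the Markov property for it is the corresponding property with $B$ in place of $A$, including the extended independences that involve the retained regime indicators $F_B$: for all $i\in V$, $$W_i\perp F_{B\setminus \mathrm{pa}(i)},\,W_{\mathrm{pre}(i)\setminus(\mathrm{pa}(i)\setminus B)}\mid W_{\mathrm{pa}(i)\setminus B},\,F_{B\cap \mathrm{pa}(i)},\,F_B\neq\emptyset$$ (with $F_{A\setminus B}$ idle); i.e. as $b$ ranges over $\mathfrak{X}_B$ and $w$ over $\mathfrak{X}_{\mathrm{pre}(i)}$, $p(W_i\mid W_{\mathrm{pre}(i)}=w,F_B=b)$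 is a function only of $b_{B\cap\mathrm{pa}(i)}$ and $w_{\mathrm{pa}(i)\setminus B}$. These are d-separations of $W_i$ in $\mathcal{G}^{**}$ from the listed random variables and regime indicators given its parents in $\mathcal{G}^{**}$.
   Formalization: Identification of p(W_V | F_B=b) is stated under positivity: the observed conditioning events on the right-hand side must have positive probability for every w in its support (at w* for a single value); the equation holds where both sides are defined. Without positivity identification fails. *)

theory Defs
  imports "HOL-Probability.Probability" "Graph_Theory.Graph_Theory"
begin

text \<open>
  Assignments to a set \<open>D\<close> of variables are elements of \<open>PiE D X\<close>, where \<open>X i\<close> is the state space
  of variable \<open>i\<close>.  A regime is a partial map: indicators outside its domain are idle.  A kernel
  gives a discrete distribution of the vector of all variables for each regime; only its values at
  regimes that send a subset of the targets to admissible states are meaningful.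
\<close>

type_synonym 'v assignment = "nat \<Rightarrow> 'v"
type_synonym 'v regime = "nat \<rightharpoonup> 'v"
type_synonym 'v kernel = "'v regime \<Rightarrow> 'v assignment pmf"

definition set_to :: "nat set \<Rightarrow> 'v assignment \<Rightarrow> 'v regime" where
  "set_to C c = (\<lambda>j. Some (c j)) |` C"

definition observed :: "'v kernel \<Rightarrow> 'v assignment pmf" where
  "observed K = K Map.empty"

definition agree :: "nat set \<Rightarrow> 'v assignment \<Rightarrow> 'v assignment \<Rightarrow> bool" where
  "agree D u v \<longleftrightarrow> (\<forall>j\<in>D. u j = v j)"

definition pre :: "nat \<Rightarrow> nat set" where
  "pre i = {1..<i}"

definition is_kernel :: "nat set \<Rightarrow> (nat \<Rightarrow> 'v set) \<Rightarrow> nat set \<Rightarrow> 'v kernel \<Rightarrow> bool" where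
  "is_kernel V X A K \<longleftrightarrow>
     (\<forall>C a. C \<subseteq> A \<and> a \<in> PiE C X \<longrightarrow> set_pmf (K (set_to C a)) \<subseteq> PiE V X)"

text \<open>
  The dynamic regime that sets target \<open>j\<close> to its natural value gives \<open>W\<^sub>V = v\<close> the probability
  that the static regime \<open>F\<^sub>j = v\<^sub>j\<close> gives it; so independence of \<open>W\<^sub>V\<close> and the indicator with values
  idle and natural-value is the following equation.
\<close>

definition distributional_consistency ::
  "nat set \<Rightarrow> (nat \<Rightarrow> 'v set) \<Rightarrow> nat set \<Rightarrow> 'v kernel \<Rightarrow> bool" where
  "distributional_consistency V X A K \<longleftrightarrow>
     (\<forall>j\<in>A. \<forall>C\<subseteq>A - {j}. \<forall>c\<in>PiE C X. \<forall>v\<in>PiE V X.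
        pmf (K ((set_to C c)(j \<mapsto> v j))) v = pmf (K (set_to C c)) v)"

datatype node = RV nat | Ind nat

definition pa :: "nat pair_pre_digraph \<Rightarrow> nat \<Rightarrow> nat set" where
  "pa G i = {j. (j, i) \<in> parcs G}"

definition augmented :: "nat pair_pre_digraph \<Rightarrow> nat set \<Rightarrow> node pair_pre_digraph" where
  "augmented G A =
     \<lparr> pverts = RV ` pverts G \<union> Ind ` A,
       parcs = {(RV i, RV j) | i j. (i, j) \<in> parcs G}
             \<union> {(Ind i, RV j) | i j. i \<in> A \<and> (i, j) \<in> parcs G} \<rparr>"

definition intervened :: "nat pair_pre_digraph \<Rightarrow> nat set \<Rightarrow> nat set \<Rightarrow> node pair_pre_digraph" where
  "intervened G A B =
     \<lparr> pverts = pverts (augmented G A) - Ind ` (A - B),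
       parcs = {(u, v) \<in> parcs (augmented G A). u \<notin> RV ` B \<and> u \<notin> Ind ` (A - B)} \<rparr>"

text \<open>
  The local Markov property is read off an augmented graph \<open>H\<close>: \<open>T\<close> is the set of targets whose
  regime indicators occur in \<open>H\<close>.  These indicators are non-idle and all others are idle.  Given
  the assignment to its predecessors, the law of \<open>W\<^sub>i\<close> depends only on its parent indicators and on
  its parent variables outside \<open>T\<close> (when the indicators are non-idle, the edges of \<open>H\<close> leaving a
  variable in \<open>T\<close> are inactive).  Only conditioning events of positive probability are compared.
\<close>

definition local_markov :: "(nat \<Rightarrow> 'v set) \<Rightarrow> node pair_pre_digraph \<Rightarrow> 'v kernel \<Rightarrow> bool" where
  "local_markov X H K \<longleftrightarrow>
     (let T = {j. Ind j \<in> pverts H} in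
      \<forall>i. RV i \<in> pverts H \<longrightarrow>
        (\<forall>a\<in>PiE T X. \<forall>a'\<in>PiE T X. \<forall>w\<in>PiE (pre i) X. \<forall>w'\<in>PiE (pre i) X.
           agree {j. (Ind j, RV i) \<in> parcs H} a a' \<longrightarrow>
           agree ({j. (RV j, RV i) \<in> parcs H} - T) w w' \<longrightarrow>
           \<P>(u in measure_pmf (K (set_to T a)). agree (pre i) u w) > 0 \<longrightarrow>
           \<P>(u in measure_pmf (K (set_to T a')). agree (pre i) u w') > 0 \<longrightarrow>
           (\<forall>x\<in>X i.
              \<P>(u in measure_pmf (K (set_to T a)). u i = x \<bar> agree (pre i) u w) =
              \<P>(u in measure_pmf (K (set_to T a')). u i = x \<bar> agree (pre i) u w'))))"

lemma parents_augmented: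
  "{j. Ind j \<in> pverts (augmented G A)} = A"
  "{j. (Ind j, RV i) \<in> parcs (augmented G A)} = A \<inter> pa G i"
  "{j. (RV j, RV i) \<in> parcs (augmented G A)} - A = pa G i - A"
  by (auto simp: augmented_def pa_def)

lemma parents_intervened:
  assumes "B \<subseteq> A"
  shows "{j. Ind j \<in> pverts (intervened G A B)} = B"
    "{j. (Ind j, RV i) \<in> parcs (intervened G A B)} = B \<inter> pa G i"
    "{j. (RV j, RV i) \<in> parcs (intervened G A B)} = pa G i - B"
  using assms by (auto simp: intervened_def augmented_def pa_def)

definition causal_model ::
  "(nat \<Rightarrow> 'v set) \<Rightarrow> nat pair_pre_digraph \<Rightarrow> nat set \<Rightarrow> 'v kernel \<Rightarrow> bool" where
  "causal_model X G A K \<longleftrightarrow>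
     is_kernel (pverts G) X A K \<and>
     distributional_consistency (pverts G) X A K \<and>
     local_markov X (augmented G A) K"

definition identified_given_observed ::
  "('v kernel \<Rightarrow> bool) \<Rightarrow> ('v kernel \<Rightarrow> 'c) \<Rightarrow> 'v kernel \<Rightarrow> bool" where
  "identified_given_observed M \<theta> K \<longleftrightarrow>
     (\<forall>K'. M K' \<longrightarrow> observed K' = observed K \<longrightarrow> \<theta> K' = \<theta> K)"

definition parent_event ::
  "nat pair_pre_digraph \<Rightarrow> nat set \<Rightarrow> 'v assignment \<Rightarrow> 'v assignment \<Rightarrow> nat \<Rightarrow> 'v assignment \<Rightarrow> bool"
  where
  "parent_event G B b w i u \<longleftrightarrow> agree (pa G i \<inter> B) u b \<and> agree (pa G i - B) u w"

text \<open>
  Positivity: all the observed conditional distributions that enter the factorisation at the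
  assignment \<open>w\<close> are well defined.
\<close>

definition factors_defined ::
  "nat pair_pre_digraph \<Rightarrow> 'v assignment pmf \<Rightarrow> nat set \<Rightarrow> 'v assignment \<Rightarrow> 'v assignment \<Rightarrow> bool"
  where
  "factors_defined G P B b w \<longleftrightarrow>
     (\<forall>i\<in>pverts G. \<P>(u in measure_pmf P. parent_event G B b w i u) > 0)"

end

theory Submission
  imports Defs
begin

text \<open>
  Write \<open>P\<^sub>C\<^sub>,\<^sub>c\<close> for the law under \<open>F\<^sub>C = c\<close>.  By the local Markov property and induction along the
  ordering, under a full intervention \<open>a\<close> the law of \<open>W\<^sub>1, \<dots>, W\<^sub>k\<close> depends only on the
  coordinates of \<open>a\<close> below \<open>k\<close>.  Iterated consistency turns \<open>P\<^sub>B\<^sub>,\<^sub>b(W\<^sub>V = v)\<close> into \<open>P\<^sub>A\<^sub>,\<^sub>a(W\<^sub>V = v)\<close> with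
  \<open>a = b\<close> on \<open>B\<close> and \<open>a = v\<close> on \<open>A - B\<close>; summing out the last coordinates one at a time, which is
  possible because the earlier ones do not feel the later interventions, gives the same identity
  for initial segments.  Hence the conditional law of \<open>W\<^sub>i\<close> given its past under \<open>F\<^sub>B = b\<close> is one
  under a full intervention, and so is the observed one (the case of no targets).  Both are
  governed by the Markov property for \<open>A\<close>, and averaging the observed one over the
  non-parents in the past gives the formula.
\<close>

section \<open>Assignments, regimes and discrete laws\<close>

lemma agree_restrict [simp]:
  "agree D (restrict u D) v \<longleftrightarrow> agree D u v" "agree D u (restrict v D) \<longleftrightarrow> agree D u v"
  by (auto simp: agree_def)

lemma set_to_cong: "agree C c d \<Longrightarrow> set_to C c = set_to C d"
  by (auto simp: set_to_def agree_def restrict_map_def)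

lemma set_to_update: "(set_to C c)(j \<mapsto> c j) = set_to (insert j C) c"
  by (auto simp: set_to_def restrict_map_def)

lemma observed_eq: "observed K = K (set_to {} c)"
  by (simp add: observed_def set_to_def)

text \<open>Both events are split into fibres over a common, possibly infinite index type, and
  \<open>c\<close> comes out of the sum. It serves twice: to sum out one coordinate
  (\<open>c = 1\<close>) and to average over pasts.\<close>

lemma prob_proportional_fibres:
  fixes P :: "'a pmf" and Q :: "'b pmf" and f :: "'a \<Rightarrow> 'c" and g :: "'b \<Rightarrow> 'c"
  assumes "\<And>y. measure_pmf.prob P {u. E u \<and> f u = y} = c * measure_pmf.prob Q {u. E' u \<and> g u = y}"
  shows "measure_pmf.prob P {u. E u} = c * measure_pmf.prob Q {u. E' u}"
proof -
  \<comment> \<open>The Boolean component marks the event, so its probability is a sum of point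
    masses of one joint law.\<close>
  have disintegrate: "measure_pmf.prob R {u. D u} =
      infsetsum (pmf (map_pmf (\<lambda>u. (D u, h u)) R)) ({True} \<times> UNIV)"
    for R :: "'d pmf" and D and h :: "'d \<Rightarrow> 'c"
    unfolding measure_pmf_conv_infsetsum [symmetric] measure_map_pmf
    by (rule arg_cong[where f = "measure_pmf.prob R"]) auto
  have fibre: "pmf (map_pmf (\<lambda>u. (D u, h u)) R) (True, y) = measure_pmf.prob R {u. D u \<and> h u = y}"
    for R :: "'d pmf" and D and h :: "'d \<Rightarrow> 'c" and y
    unfolding pmf_map by (rule arg_cong[where f = "measure_pmf.prob R"]) auto
  show ?thesis
    unfolding disintegrate[of P E f] disintegrate[of Q E' g]
    by (subst infsetsum_cmult_right [symmetric])
      (auto intro!: infsetsum_cong pmf_abs_summable simp: fibre assms)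
qed

text \<open>The support of \<open>P\<close> has mass 1 under \<open>Q\<close> as well, so
  \<open>Q\<close> has no mass left elsewhere.\<close>

lemma pmf_eqI_support:
  assumes "\<And>x. x \<in> set_pmf P \<Longrightarrow> pmf Q x = pmf P x"
  shows "Q = P"
proof -
  have "measure_pmf.prob Q (set_pmf P) = measure_pmf.prob P (set_pmf P)"
    unfolding measure_pmf_conv_infsetsum using assms by (rule infsetsum_cong) auto
  also have "\<dots> = 1"
    by (simp add: measure_pmf.prob_eq_1 AE_measure_pmf)
  finally have "set_pmf Q \<subseteq> set_pmf P"
    by (auto simp: measure_pmf.prob_eq_1 AE_measure_pmf_iff)
  then show ?thesis
    using assms by (intro pmf_eqI) (metis pmf_eq_0_set_pmf subsetD)
qed

section \<open>Laws of initial segments\<close>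

text \<open>The index is exclusive: only coordinates below \<open>i\<close> count. With
  \<open>p\<close> variables, \<open>Suc 0\<close> gives the empty segment and \<open>Suc p\<close>
  the whole vector.\<close>

definition prefix_prob :: "'v assignment pmf \<Rightarrow> nat \<Rightarrow> 'v assignment \<Rightarrow> real" where
  "prefix_prob P i w = \<P>(u in measure_pmf P. agree (pre i) u w)"

lemma prefix_prob_cong: "agree (pre i) w w' \<Longrightarrow> prefix_prob P i w = prefix_prob P i w'"
  unfolding prefix_prob_def
  by (rule arg_cong[where f = "measure_pmf.prob P"]) (auto simp: agree_def)

lemma prefix_prob_1 [simp]: "prefix_prob P (Suc 0) w = 1"
  by (simp add: prefix_prob_def agree_def pre_def measure_pmf.prob_space[simplified])

lemma agree_pre_Suc:
  "1 \<le> i \<Longrightarrow> agree (pre (Suc i)) u (w(i := x)) \<longleftrightarrow> u i = x \<and> agree (pre i) u w"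
  by (auto simp: agree_def pre_def less_Suc_eq)

lemma cond_prob_prefix:
  assumes "1 \<le> i"
  shows "\<P>(u in measure_pmf P. u i = x \<bar> agree (pre i) u w) =
    prefix_prob P (Suc i) (w(i := x)) / prefix_prob P i w"
  using assms by (simp add: cond_prob_def prefix_prob_def agree_pre_Suc)

lemma prefix_prob_nonneg [simp]: "prefix_prob P i w \<ge> 0"
  by (simp add: prefix_prob_def)

lemma prefix_prob_Suc_eq_0:
  assumes "prefix_prob P i w = 0"
  shows "prefix_prob P (Suc i) w = 0"
proof -
  have "prefix_prob P (Suc i) w \<le> prefix_prob P i w"
    unfolding prefix_prob_def
    by (rule measure_pmf.finite_measure_mono) (auto simp: agree_def pre_def)
  then show ?thesis
    using assms prefix_prob_nonneg[of P "Suc i" w] by linarith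
qed

section \<open>The model: support, consistency, Markov property\<close>

text \<open>A locale, so that identification can interpret it again for a rival kernel on the same
  graph.\<close>

locale ordered_causal_model =
  fixes p :: nat and X :: "nat \<Rightarrow> 'v set" and G :: "nat pair_pre_digraph"
    and A :: "nat set" and K :: "'v kernel"
  assumes vertices: "pverts G = {1..p}"
    and ordered: "(i, j) \<in> parcs G \<Longrightarrow> i < j"
    and parcs_subset: "(i, j) \<in> parcs G \<Longrightarrow> i \<in> pverts G"
    and targets: "A \<subseteq> {1..p}"
    and model: "causal_model X G A K"
begin

lemma pa_subset_pre: "pa G i \<subseteq> pre i"
  using parcs_subset ordered vertices by (fastforce simp: pa_def pre_def)

text \<open>\<open>Pi\<close> instead of \<open>PiE\<close>: since \<open>set_to\<close> reads
  \<open>c\<close> only on \<open>C\<close>, one total assignment can serve several target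
  sets.\<close>

lemma support:
  assumes "C \<subseteq> A" "c \<in> Pi C X"
  shows "set_pmf (K (set_to C c)) \<subseteq> PiE {1..p} X"
proof -
  have "set_pmf (K (set_to C (restrict c C))) \<subseteq> PiE {1..p} X"
    using model assms vertices unfolding causal_model_def is_kernel_def by auto
  then show ?thesis
    by (simp add: set_to_cong[of C "restrict c C" c] agree_def)
qed

lemma states_nonempty: "i \<in> {1..p} \<Longrightarrow> X i \<noteq> {}"
  using support[of "{}" undefined] set_pmf_not_empty by fastforce

lemma consistency_step:
  assumes "insert j C \<subseteq> A" "j \<notin> C" "c \<in> Pi C X" "v \<in> PiE {1..p} X" "c j = v j"
  shows "pmf (K (set_to (insert j C) c)) v = pmf (K (set_to C c)) v"
proof -
  have "j \<in> A" "C \<subseteq> A - {j}" "restrict c C \<in> PiE C X"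
    using assms by auto
  then have "pmf (K ((set_to C (restrict c C))(j \<mapsto> v j))) v = pmf (K (set_to C (restrict c C))) v"
    using model assms(4) unfolding causal_model_def distributional_consistency_def vertices by blast
  moreover have "set_to C (restrict c C) = set_to C c"
    by (rule set_to_cong) (simp add: agree_def)
  ultimately show ?thesis
    using assms(5) set_to_update[of C c j] by simp
qed

text \<open>The targets outside \<open>B\<close> are intervened on one by one, each set to its
  natural value \<open>v j\<close>, which leaves the mass of \<open>v\<close> unchanged.\<close>

lemma consistency:
  assumes "B \<subseteq> A" "a \<in> Pi A X" "v \<in> PiE {1..p} X" "agree (A - B) a v"
  shows "pmf (K (set_to B a)) v = pmf (K (set_to A a)) v"
proof -
  have "finite (A - B)"
    using targets finite_subset by blast
  moreover have "pmf (K (set_to (B \<union> D) a)) v = pmf (K (set_to B a)) v"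
    if "finite D" "D \<subseteq> A - B" for D
    using that
  proof (induction D rule: finite_induct)
    case (insert j D)
    then have "a \<in> Pi (B \<union> D) X" "insert j (B \<union> D) \<subseteq> A" "j \<notin> B \<union> D" "a j = v j"
      using assms by (auto simp: agree_def)
    then show ?case
      using consistency_step[of j "B \<union> D" a v] assms(3) insert by simp
  qed simp
  ultimately show ?thesis
    using assms(1) by (metis Un_Diff_cancel Un_absorb1 subset_refl)
qed

lemma markov:
  assumes "i \<in> {1..p}" "a \<in> Pi A X" "a' \<in> Pi A X" "w \<in> Pi (pre i) X" "w' \<in> Pi (pre i) X"
    and "agree (A \<inter> pa G i) a a'" "agree (pa G i - A) w w'" "x \<in> X i"
    and "prefix_prob (K (set_to A a)) i w > 0" "prefix_prob (K (set_to A a')) i w' > 0"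
  shows "prefix_prob (K (set_to A a)) (Suc i) (w(i := x)) / prefix_prob (K (set_to A a)) i w =
    prefix_prob (K (set_to A a')) (Suc i) (w'(i := x)) / prefix_prob (K (set_to A a')) i w'"
proof -
  have i: "RV i \<in> pverts (augmented G A)"
    using assms(1) vertices by (auto simp: augmented_def)
  have restricted: "set_to A (restrict c A) = set_to A c" for c :: "'v assignment"
    by (rule set_to_cong) (simp add: agree_def)
  have "agree (A \<inter> pa G i) (restrict a A) (restrict a' A)"
    "agree (pa G i - A) (restrict w (pre i)) (restrict w' (pre i))"
    using assms(6,7) pa_subset_pre[of i] by (auto simp: agree_def)
  moreover have "restrict a A \<in> PiE A X" "restrict a' A \<in> PiE A X"
    "restrict w (pre i) \<in> PiE (pre i) X" "restrict w' (pre i) \<in> PiE (pre i) X"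
    using assms by auto
  moreover have "local_markov X (augmented G A) K"
    using model by (simp add: causal_model_def)
  note this[unfolded local_markov_def Let_def parents_augmented, rule_format, OF i,
      of "restrict a A" "restrict a' A" "restrict w (pre i)" "restrict w' (pre i)" x,
      unfolded restricted agree_restrict]
  ultimately have "\<P>(u in measure_pmf (K (set_to A a)). u i = x \<bar> agree (pre i) u w) =
      \<P>(u in measure_pmf (K (set_to A a')). u i = x \<bar> agree (pre i) u w')"
    using assms(8-10) unfolding prefix_prob_def by blast
  then show ?thesis
    using assms(1) by (simp add: cond_prob_prefix)
qed

text \<open>Chain rule: the factor of each coordinate involves only the indicators of its parents,
  which come strictly earlier. Hence \<open>pre k\<close> excludes even the indicator of the last
  coordinate \<open>k\<close>: a target reports its natural value.\<close>

lemma full_intervention_prefix: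
  assumes "k \<le> p" "a \<in> Pi A X" "a' \<in> Pi A X" "agree (A \<inter> pre k) a a'" "w \<in> Pi (pre (Suc k)) X"
  shows "prefix_prob (K (set_to A a)) (Suc k) w = prefix_prob (K (set_to A a')) (Suc k) w"
  using assms
proof (induction k)
  case (Suc k)
  let ?P = "prefix_prob (K (set_to A a))" and ?P' = "prefix_prob (K (set_to A a'))"
  have eq: "?P (Suc k) w = ?P' (Suc k) w"
    using Suc by (intro Suc.IH) (auto simp: agree_def pre_def)
  show ?case
  proof (cases "?P (Suc k) w = 0")
    case True
    then show ?thesis
      using eq by (simp add: prefix_prob_Suc_eq_0)
  next
    case False
    then have "?P (Suc k) w > 0" "?P' (Suc k) w > 0"
      using eq prefix_prob_nonneg[of "K (set_to A a)" "Suc k" w] by linarith+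
    then have "?P (Suc (Suc k)) (w(Suc k := w (Suc k))) / ?P (Suc k) w =
        ?P' (Suc (Suc k)) (w(Suc k := w (Suc k))) / ?P' (Suc k) w"
      using Suc.prems pa_subset_pre[of "Suc k"]
      by (intro markov) (auto simp: agree_def pre_def)
    then show ?thesis
      using False eq by simp
  qed
qed simp

section \<open>From partial to full interventions\<close>

lemma prefix_prob_outside:
  assumes "C \<subseteq> A" "c \<in> Pi C X" "i \<le> p" "1 \<le> i" "w i \<notin> X i"
  shows "prefix_prob (K (set_to C c)) (Suc i) w = 0"
proof -
  have "u i \<noteq> w i" if "u \<in> set_pmf (K (set_to C c))" for u
    using that support[OF assms(1,2)] assms(3-5) by (metis PiE_mem atLeastAtMost_iff subsetD)
  then show ?thesis
    using assms(4) unfolding prefix_prob_def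
    by (force simp: measure_pmf.prob_eq_0 AE_measure_pmf_iff agree_def pre_def)
qed

lemma prefix_prob_total:
  assumes "C \<subseteq> A" "c \<in> Pi C X" "v \<in> PiE {1..p} X"
  shows "prefix_prob (K (set_to C c)) (Suc p) v = pmf (K (set_to C c)) v"
proof -
  have "u = v" if "u \<in> set_pmf (K (set_to C c))" "agree (pre (Suc p)) u v" for u
    using that support[OF assms(1,2)] assms(3)
    by (intro PiE_ext[of u "{1..p}" X v]) (auto simp: agree_def pre_def)
  then have "prefix_prob (K (set_to C c)) (Suc p) v = measure_pmf.prob (K (set_to C c)) {v}"
    unfolding prefix_prob_def
    by (intro measure_pmf.finite_measure_eq_AE) (auto simp: AE_measure_pmf_iff agree_def)
  then show ?thesis
    by (simp add: pmf.rep_eq)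
qed

text \<open>Downward induction from the whole vector, where iterated consistency applies; each step
  sums out the last coordinate.\<close>

lemma prefix_prob_intervention:
  assumes "B \<subseteq> A" "1 \<le> k" "k \<le> Suc p"
    and "a \<in> Pi A X" "w \<in> Pi (pre k) X" "agree ((A - B) \<inter> pre k) a w"
  shows "prefix_prob (K (set_to B a)) k w = prefix_prob (K (set_to A a)) k w"
  using assms(3,2,4-6)
proof (induction k arbitrary: a w rule: inc_induct)
  case base
  define v where "v = restrict w {1..p}"
  have pre: "pre (Suc p) = {1..p}"
    by (auto simp: pre_def)
  have v: "v \<in> PiE {1..p} X" "agree (A - B) a v"
    using base targets by (auto simp: v_def pre agree_def)
  have "prefix_prob P (Suc p) w = prefix_prob P (Suc p) v" for P
    by (rule prefix_prob_cong) (auto simp: agree_def v_def pre)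
  then show ?case
    using prefix_prob_total v assms(1) base consistency[OF assms(1) base(2) v]
    by (simp add: Pi_def subset_iff)
next
  case (step k)
  have "prefix_prob (K (set_to B a)) (Suc k) (w(k := x)) =
      prefix_prob (K (set_to A a)) (Suc k) (w(k := x))" for x
  proof (cases "x \<in> X k")
    \<comment> \<open>The sum runs over the whole type; inadmissible values have mass 0 on both
      sides.\<close>
    case False
    then show ?thesis
      using step assms(1) by (subst (1 2) prefix_prob_outside) (auto simp: Pi_def)
  next
    case True
    \<comment> \<open>The full intervention must match the appended value \<open>x\<close>, so
      \<open>a\<close> is altered at \<open>k\<close> when \<open>k\<close> is a target outside
      \<open>B\<close>. The coordinates up to \<open>k\<close> do not feel this change.\<close>
    define a' where "a' = (if k \<in> A - B then a(k := x) else a)"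
    have a': "a' \<in> Pi A X" "agree B a a'" "agree (A \<inter> pre k) a' a"
      "agree ((A - B) \<inter> pre (Suc k)) a' (w(k := x))"
      using step True by (auto simp: a'_def agree_def pre_def less_Suc_eq)
    have w: "w(k := x) \<in> Pi (pre (Suc k)) X"
      using step True by (auto simp: pre_def less_Suc_eq)
    have "prefix_prob (K (set_to B a)) (Suc k) (w(k := x)) =
        prefix_prob (K (set_to B a')) (Suc k) (w(k := x))"
      using set_to_cong[OF a'(2)] by simp
    also have "\<dots> = prefix_prob (K (set_to A a')) (Suc k) (w(k := x))"
      using step.IH a' w by simp
    also have "\<dots> = prefix_prob (K (set_to A a)) (Suc k) (w(k := x))"
      using full_intervention_prefix a' w step by simp
    finally show ?thesis .
  qed
  then have "measure_pmf.prob (K (set_to B a)) {u. agree (pre k) u w \<and> u k = x} =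
      1 * measure_pmf.prob (K (set_to A a)) {u. agree (pre k) u w \<and> u k = x}" for x
    using step.prems by (simp add: prefix_prob_def agree_pre_Suc conj_commute)
  from prob_proportional_fibres[OF this] show ?case
    by (simp add: prefix_prob_def)
qed

text \<open>One \<open>a\<close> serves both segment lengths and every \<open>x\<close>, so a
  conditional law under \<open>F_B = b\<close> becomes a conditional law under a full
  intervention.\<close>

lemma completion:
  assumes "B \<subseteq> A" "b \<in> Pi B X" "i \<in> {1..p}" "w \<in> Pi (pre i) X"
  obtains a where "a \<in> Pi A X" "agree B a b" "agree ((A - B) \<inter> pre i) a w"
    "prefix_prob (K (set_to B b)) i w = prefix_prob (K (set_to A a)) i w"
    "\<And>x. x \<in> X i \<Longrightarrow> prefix_prob (K (set_to B b)) (Suc i) (w(i := x)) =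
       prefix_prob (K (set_to A a)) (Suc i) (w(i := x))"
proof -
  \<comment> \<open>Matching the value at \<open>i\<close> may require a different
    \<open>a x\<close> for each \<open>x\<close>, but the first \<open>i\<close> coordinates have
    the same law under all of them, so a fixed \<open>x0\<close> will do. Targets beyond
    \<open>i\<close> and outside \<open>B\<close> get an arbitrary admissible value.\<close>
  define a where "a x j = (if j \<in> B then b j else if j \<in> pre i then w j
    else if j = i then x else (SOME y. y \<in> X j))" for x j
  have "a x j \<in> X j" if "x \<in> X i" "j \<in> A" for x j
  proof -
    have "(SOME y. y \<in> X j) \<in> X j"
      using states_nonempty[of j] targets that by (auto simp: some_in_eq)
    then show ?thesis
      using assms that by (auto simp: a_def)
  qed
  then have a: "a x \<in> Pi A X" "agree B (a x) b" "agree ((A - B) \<inter> pre i) (a x) w"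
    "agree ((A - B) \<inter> pre (Suc i)) (a x) (w(i := x))" if "x \<in> X i" for x
    using that by (auto simp: a_def agree_def pre_def less_Suc_eq)
  have same: "agree (A \<inter> pre i) (a x) (a y)" for x y
    by (auto simp: a_def agree_def)
  obtain x0 where x0: "x0 \<in> X i"
    using states_nonempty assms by blast
  have set_to: "set_to B (a x) = set_to B b" if "x \<in> X i" for x
    using a that set_to_cong by blast
  show thesis
  proof
    show "a x0 \<in> Pi A X" "agree B (a x0) b" "agree ((A - B) \<inter> pre i) (a x0) w"
      using a x0 by auto
    show "prefix_prob (K (set_to B b)) i w = prefix_prob (K (set_to A (a x0))) i w"
      using prefix_prob_intervention[of B i "a x0" w] a x0 assms set_to by simp
    fix x assume x: "x \<in> X i"
    have w: "w(i := x) \<in> Pi (pre (Suc i)) X"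
      using assms x by (auto simp: pre_def less_Suc_eq)
    show "prefix_prob (K (set_to B b)) (Suc i) (w(i := x)) =
       prefix_prob (K (set_to A (a x0))) (Suc i) (w(i := x))"
      using prefix_prob_intervention[of B "Suc i" "a x" "w(i := x)"] a x assms set_to w
        full_intervention_prefix[of i "a x" "a x0" "w(i := x)"] x0 same by simp
  qed
qed

section \<open>Comparison of interventions and the identification formula\<close>

text \<open>Coordinate \<open>i\<close> sees a parent at its set value if it is intervened on, and
  at its natural value otherwise. The case \<open>C = {}\<close> yields the identification formula,
  the case \<open>C = B\<close> the Markov property.\<close>

lemma compare_interventions:
  assumes "B \<subseteq> A" "C \<subseteq> A" "b \<in> Pi B X" "c \<in> Pi C X" "i \<in> {1..p}"
    and "w \<in> Pi (pre i) X" "w' \<in> Pi (pre i) X" "x \<in> X i"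
    and "\<And>j. j \<in> pa G i \<Longrightarrow> (if j \<in> B then b j else w j) = (if j \<in> C then c j else w' j)"
    and "prefix_prob (K (set_to B b)) i w > 0" "prefix_prob (K (set_to C c)) i w' > 0"
  shows "prefix_prob (K (set_to B b)) (Suc i) (w(i := x)) / prefix_prob (K (set_to B b)) i w =
    prefix_prob (K (set_to C c)) (Suc i) (w'(i := x)) / prefix_prob (K (set_to C c)) i w'"
proof -
  obtain a where a: "a \<in> Pi A X" "agree B a b" "agree ((A - B) \<inter> pre i) a w"
    "prefix_prob (K (set_to B b)) i w = prefix_prob (K (set_to A a)) i w"
    "\<And>x. x \<in> X i \<Longrightarrow> prefix_prob (K (set_to B b)) (Suc i) (w(i := x)) =
       prefix_prob (K (set_to A a)) (Suc i) (w(i := x))"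
    using completion[of B b i w] assms by blast
  obtain a' where a': "a' \<in> Pi A X" "agree C a' c" "agree ((A - C) \<inter> pre i) a' w'"
    "prefix_prob (K (set_to C c)) i w' = prefix_prob (K (set_to A a')) i w'"
    "\<And>x. x \<in> X i \<Longrightarrow> prefix_prob (K (set_to C c)) (Suc i) (w'(i := x)) =
       prefix_prob (K (set_to A a')) (Suc i) (w'(i := x))"
    using completion[of C c i w'] assms by blast
  have agree_parents: "agree (A \<inter> pa G i) a a'" "agree (pa G i - A) w w'"
  proof -
    \<comment> \<open>Parents precede \<open>i\<close>, where each completion copies the natural
      values at the targets not yet set.\<close>
    have "a j = (if j \<in> B then b j else w j)" "a' j = (if j \<in> C then c j else w' j)"
      if "j \<in> A \<inter> pa G i" for j
      using that a(2,3) a'(2,3) pa_subset_pre[of i] by (auto simp: agree_def)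
    then show "agree (A \<inter> pa G i) a a'"
      using assms(9) by (simp add: agree_def)
    show "agree (pa G i - A) w w'"
      unfolding agree_def using assms(1,2,9) by (metis DiffD1 DiffD2 subsetD)
  qed
  show ?thesis
    using markov[OF assms(5) a(1) a'(1) assms(6,7) agree_parents assms(8)] assms(8,10,11)
      a(4,5) a'(4,5) by simp
qed

text \<open>Every observed past of positive probability that satisfies the parent event gives the
  same conditional probability \<open>c\<close>, so averaging over these pasts returns
  \<open>c\<close>.\<close>

lemma identification_formula:
  assumes "B \<subseteq> A" "b \<in> Pi B X" "ws \<in> Pi {1..p} X" "i \<in> {1..p}"
    and pos: "prefix_prob (K (set_to B b)) i ws > 0"
    and pos': "\<P>(u in measure_pmf (observed K). parent_event G B b ws i u) > 0"
  shows "\<P>(u in measure_pmf (K (set_to B b)). u i = ws i \<bar> agree (pre i) u ws) =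
    \<P>(u in measure_pmf (observed K). u i = ws i \<bar> parent_event G B b ws i u)"
proof -
  \<comment> \<open>This is the left-hand side; the trivial update gives it the shape used in
    \<open>compare_interventions\<close>.\<close>
  define c where "c = prefix_prob (K (set_to B b)) (Suc i) (ws(i := ws i)) /
    prefix_prob (K (set_to B b)) i ws"
  let ?O = "observed K"
  have ws: "ws \<in> Pi (pre i) X" "ws i \<in> X i"
    using assms by (auto simp: pre_def)
  have O: "?O = K (set_to {} b)"
    by (rule observed_eq)
  \<comment> \<open>In product form the equation also covers pasts of observed probability
    0.\<close>
  have prefix: "prefix_prob ?O (Suc i) (y(i := ws i)) = c * prefix_prob ?O i y"
    if "y \<in> Pi (pre i) X" "parent_event G B b ws i y" for y
  proof (cases "prefix_prob ?O i y = 0")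
    case True
    then have "prefix_prob ?O i (y(i := ws i)) = 0"
      using prefix_prob_cong[of i "y(i := ws i)" y ?O] by (auto simp: agree_def pre_def)
    then show ?thesis
      using prefix_prob_Suc_eq_0 True by simp
  next
    case False
    then have "prefix_prob ?O i y > 0"
      using prefix_prob_nonneg[of ?O i y] by linarith
    then have "c = prefix_prob ?O (Suc i) (y(i := ws i)) / prefix_prob ?O i y"
      unfolding c_def O using assms ws that
      by (intro compare_interventions) (auto simp: parent_event_def agree_def)
    then show ?thesis
      using False by simp
  qed
  have parents: "parent_event G B b ws i u \<longleftrightarrow> parent_event G B b ws i y" if "agree (pre i) u y" for u y
    using that pa_subset_pre[of i] by (auto simp: parent_event_def agree_def subset_iff)
  \<comment> \<open>Fibres are indexed by the entire past. It contains the parents, so each fibre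
    lies inside or outside the parent event.\<close>
  have "measure_pmf.prob ?O {u. (u i = ws i \<and> parent_event G B b ws i u) \<and> restrict u (pre i) = y} =
      c * measure_pmf.prob ?O {u. parent_event G B b ws i u \<and> restrict u (pre i) = y}" for y
  proof (cases "y \<in> PiE (pre i) X \<and> parent_event G B b ws i y")
    case True
    have "restrict u (pre i) = y \<longleftrightarrow> agree (pre i) u y" for u
      using True by (auto simp: agree_def fun_eq_iff restrict_def PiE_def extensional_def)
    moreover have "i \<ge> 1"
      using assms by simp
    moreover have "(parent_event G B b ws i u \<and> agree (pre i) u y) \<longleftrightarrow> agree (pre i) u y" for u
      using True parents by blast
    ultimately show ?thesis
      using prefix[of y] True by (simp add: prefix_prob_def agree_pre_Suc PiE_def)
  next
    case False
    \<comment> \<open>Such a \<open>y\<close> is inadmissible or violates the parent event, so both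
      fibres are null.\<close>
    have "restrict u (pre i) \<noteq> y" if "u \<in> set_pmf ?O" "parent_event G B b ws i u" for u
    proof
      assume y: "restrict u (pre i) = y"
      have "u \<in> PiE {1..p} X"
        using that support[of "{}" b] by (auto simp: O)
      then have "y \<in> PiE (pre i) X"
        using y assms(4) by (auto simp: pre_def)
      moreover have "parent_event G B b ws i y"
        using parents[of u y] that y by (auto simp: agree_def)
      ultimately show False
        using False by simp
    qed
    then have "measure_pmf.prob ?O
        {u. (u i = ws i \<and> parent_event G B b ws i u) \<and> restrict u (pre i) = y} = 0"
      "measure_pmf.prob ?O {u. parent_event G B b ws i u \<and> restrict u (pre i) = y} = 0"
      by (auto simp: measure_pmf.prob_eq_0 AE_measure_pmf_iff)
    then show ?thesis
      by simp
  qed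
  then have "measure_pmf.prob ?O {u. u i = ws i \<and> parent_event G B b ws i u} =
      c * measure_pmf.prob ?O {u. parent_event G B b ws i u}"
    by (rule prob_proportional_fibres)
  then have "c = \<P>(u in measure_pmf ?O. u i = ws i \<bar> parent_event G B b ws i u)"
    using pos' by (simp add: cond_prob_def)
  moreover have "\<P>(u in measure_pmf (K (set_to B b)). u i = ws i \<bar> agree (pre i) u ws) = c"
    unfolding c_def using assms by (subst cond_prob_prefix) auto
  ultimately show ?thesis
    by simp
qed

section \<open>Markov property after intervention, and identification\<close>

lemma local_markov_intervened:
  assumes "B \<subseteq> A"
  shows "local_markov X (intervened G A B) K"
proof -
  \<comment> \<open>In \<open>pa G i - B - B\<close> below, one \<open>B\<close> comes from the
    deleted edges and the other from the set \<open>T\<close> in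
    \<open>local_markov\<close>.\<close>
  have "\<P>(u in measure_pmf (K (set_to B a)). u i = x \<bar> agree (pre i) u w) =
      \<P>(u in measure_pmf (K (set_to B a')). u i = x \<bar> agree (pre i) u w')"
    if "RV i \<in> pverts (intervened G A B)" "a \<in> PiE B X" "a' \<in> PiE B X"
      "w \<in> PiE (pre i) X" "w' \<in> PiE (pre i) X"
      "agree (B \<inter> pa G i) a a'" "agree (pa G i - B - B) w w'"
      "prefix_prob (K (set_to B a)) i w > 0" "prefix_prob (K (set_to B a')) i w' > 0" "x \<in> X i"
    for i a a' w w' x
  proof -
    have i: "i \<in> {1..p}"
      using that(1) vertices by (auto simp: intervened_def augmented_def)
    then have "1 \<le> i"
      by simp
    show ?thesis
      unfolding cond_prob_prefix[OF \<open>1 \<le> i\<close>] using that i assms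
      by (intro compare_interventions) (auto simp: agree_def PiE_def)
  qed
  then show ?thesis
    unfolding local_markov_def Let_def parents_intervened[OF assms] prefix_prob_def [symmetric]
    by blast
qed

text \<open>Both kernels obey the formula with the same observed right-hand side, so their factors
  agree along the ordering. Where a segment is null the formula is silent, but then every longer
  segment is null for both.\<close>

lemma identification_prefix:
  assumes "ordered_causal_model p X G A K'" "observed K' = observed K"
    and "B \<subseteq> A" "b \<in> Pi B X" "ws \<in> Pi {1..p} X" "factors_defined G (observed K) B b ws"
    and "k \<le> p"
  shows "prefix_prob (K' (set_to B b)) (Suc k) ws = prefix_prob (K (set_to B b)) (Suc k) ws"
  using assms(7)
proof (induction k)
  case (Suc k)
  let ?P = "K (set_to B b)" and ?P' = "K' (set_to B b)"
  interpret other: ordered_causal_model p X G A K'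
    by fact
  have i: "Suc k \<in> {1..p}"
    using Suc by simp
  have eq: "prefix_prob ?P' (Suc k) ws = prefix_prob ?P (Suc k) ws"
    using Suc by simp
  show ?case
  proof (cases "prefix_prob ?P (Suc k) ws = 0")
    case True
    then show ?thesis
      using eq by (simp add: prefix_prob_Suc_eq_0)
  next
    case False
    then have pos: "prefix_prob ?P (Suc k) ws > 0" "prefix_prob ?P' (Suc k) ws > 0"
      using eq prefix_prob_nonneg[of ?P "Suc k" ws] by linarith+
    have "\<P>(u in measure_pmf (observed K). parent_event G B b ws (Suc k) u) > 0"
      using assms(6) i vertices by (simp add: factors_defined_def)
    then have "\<P>(u in measure_pmf ?P. u (Suc k) = ws (Suc k) \<bar> agree (pre (Suc k)) u ws) =
        \<P>(u in measure_pmf ?P'. u (Suc k) = ws (Suc k) \<bar> agree (pre (Suc k)) u ws)"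
      using identification_formula[OF assms(3-5) i pos(1)]
        other.identification_formula[OF assms(3-5) i pos(2)] assms(2) by simp
    then show ?thesis
      using False eq by (simp add: cond_prob_prefix)
  qed
qed simp

lemma identification:
  assumes "ordered_causal_model p X G A K'" "observed K' = observed K"
    and "B \<subseteq> A" "b \<in> Pi B X" "ws \<in> PiE {1..p} X" "factors_defined G (observed K) B b ws"
  shows "pmf (K' (set_to B b)) ws = pmf (K (set_to B b)) ws"
proof -
  interpret other: ordered_causal_model p X G A K'
    by fact
  show ?thesis
    using identification_prefix[OF assms(1-4) _ assms(6), of p] assms(3-5)
      prefix_prob_total other.prefix_prob_total by (simp add: PiE_def)
qed

end

theorem theorem22:
  fixes p :: nat
    and X :: "nat \<Rightarrow> 'v set"
    and G :: "nat pair_pre_digraph"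
    and A B :: "nat set"
    and K :: "'v kernel"
    and b ws :: "'v assignment"
  assumes "pair_wf_digraph G" and "acyclic (parcs G)"
    and "pverts G = {1..p}"
    and "\<And>i j. (i, j) \<in> parcs G \<Longrightarrow> i < j"
    and "A \<subseteq> pverts G"
    and "is_kernel (pverts G) X A K"
    and "distributional_consistency (pverts G) X A K"
    and "local_markov X (augmented G A) K"
    and "B \<subseteq> A"
    and "b \<in> PiE B X"
    and "ws \<in> PiE (pverts G) X"
  shows
    "(\<forall>i\<in>pverts G.
        \<P>(u in measure_pmf (K (set_to B b)). agree (pre i) u ws) > 0 \<longrightarrow>
        \<P>(u in measure_pmf (observed K). parent_event G B b ws i u) > 0 \<longrightarrow>
        \<P>(u in measure_pmf (K (set_to B b)). u i = ws i \<bar> agree (pre i) u ws) =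
        \<P>(u in measure_pmf (observed K). u i = ws i \<bar> parent_event G B b ws i u))
     \<and> (factors_defined G (observed K) B b ws \<longrightarrow>
          identified_given_observed (causal_model X G A) (\<lambda>K'. pmf (K' (set_to B b)) ws) K)
     \<and> ((\<forall>w\<in>set_pmf (K (set_to B b)). factors_defined G (observed K) B b w) \<longrightarrow>
          identified_given_observed (causal_model X G A) (\<lambda>K'. K' (set_to B b)) K)
     \<and> local_markov X (intervened G A B) K"
proof -
  interpret ordered_causal_model p X G A K
    using assms(1,3-8) by unfold_locales
      (auto simp: causal_model_def dest: pair_wf_digraph.arc_fst_in_verts)
  have other: "ordered_causal_model p X G A K'" if "causal_model X G A K'" for K'
    using that vertices ordered parcs_subset targets by unfold_locales auto
  have b: "b \<in> Pi B X" and ws: "ws \<in> PiE {1..p} X"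
    using assms by auto
  \<comment> \<open>Equality of masses on the support of the law of \<open>K\<close> already forces
    equality of the two laws.\<close>
  have "K' (set_to B b) = K (set_to B b)"
    if "\<forall>w\<in>set_pmf (K (set_to B b)). factors_defined G (observed K) B b w"
      "causal_model X G A K'" "observed K' = observed K" for K'
    using that support[OF assms(9) b] identification[OF other _ assms(9) b]
    by (intro pmf_eqI_support) blast
  moreover have "pmf (K' (set_to B b)) ws = pmf (K (set_to B b)) ws"
    if "factors_defined G (observed K) B b ws"
      "causal_model X G A K'" "observed K' = observed K" for K'
    using that identification[OF other _ assms(9) b ws] by blast
  moreover have "\<P>(u in measure_pmf (K (set_to B b)). u i = ws i \<bar> agree (pre i) u ws) =
      \<P>(u in measure_pmf (observed K). u i = ws i \<bar> parent_event G B b ws i u)"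
    if "i \<in> pverts G" "\<P>(u in measure_pmf (K (set_to B b)). agree (pre i) u ws) > 0"
      "\<P>(u in measure_pmf (observed K). parent_event G B b ws i u) > 0" for i
    using that identification_formula[OF assms(9) b, of ws i] ws vertices
    by (simp add: prefix_prob_def PiE_def)
  ultimately show ?thesis
    using local_markov_intervened[OF assms(9)] by (simp add: identified_given_observed_def)
qed

end
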